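(* Let $f$, $\mathbf{D}$, $\mathbf{b}$ and $\mathbf{M}$ be as defined in the context. Suppose $\lambda$ is an eigenvalue of $\mathbf{M}$, $\lambda\mathbf{I}-\mathbf{D}$ is singular, and the linear system $(\lambda\mathbf{I}-\mathbf{D})\mathbf{y}=-\mathbf{b}$ has a solution. Let $\mathbf{y}_p=-(\lambda\mathbf{I}-\mathbf{D})^{+}\mathbf{b}$. Then for every $\mathbf{y}_h\in\ker(\lambda\mathbf{I}-\mathbf{D})$ such that $\mathbf{y}_h^T\mathbf{y}_h=\lambda-\mathbf{y}_p^T\mathbf{y}_p$, the vector $\mathbf{y}=\mathbf{y}_p+\mathbf{y}_h$ is a stationary point of $f$.
   Context: Setting. Let $n,m\ge 1$, let $\mathbf{s}_1,\dots,\mathbf{s}_m\in\mathbb{R}^n$ (senders), $d_1,\dots,d_m\in\mathbb{R}$ (distance measurements), and let $\mathbf{W}=(w_{ij})\in\mathbb{R}^{m\times m}$ be symmetric positive definite. Assume (normalization) that $\sum_{i,j} w_{ij}=1$ and $\sum_{i,j} w_{ij}\mathbf{s}_i=\mathbf{0}$. Define $h:\mathbb{R}^n\to\mathbb{R}$ by $$h(\mathbf{x})=\frac14\sum_{i=1}^m\sum_{j=1}^m w_{ij}\,(\|\mathbf{x}-\mathbf{s}_i\|^2-d_i^2)(\|\mathbf{x}-\mathbf{s}_j\|^2-d_j^2).$$ Then $\nabla h(\mathbf{x})=(\mathbf{x}^T\mathbf{x})\mathbf{x}-\mathbf{A}\mathbf{x}+\mathbf{g}$, where $$\mathbf{A}=-\sum_{i,j}w_{ij}\left(2\mathbf{s}_j\mathbf{s}_i^T+(\mathbf{s}_i^T\mathbf{s}_i-d_i^2)\mathbf{I}\right),\qquad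 \mathbf{g}=-\sum_{i,j}w_{ij}(\mathbf{s}_i^T\mathbf{s}_i-d_i^2)\mathbf{s}_j,$$ and $\mathbf{A}$ is real symmetric. Let $\mathbf{Q}$ be an orthogonal matrix such that $\mathbf{D}=\mathbf{Q}^T\mathbf{A}\mathbf{Q}$ is diagonal with $D_{11}\ge D_{22}\ge\dots\ge D_{nn}$, and let $\mathbf{b}=\mathbf{Q}^T\mathbf{g}$. Define $f(\mathbf{y})=h(\mathbf{Q}\mathbf{y})$, so that $$\nabla f(\mathbf{y})=(\mathbf{y}^T\mathbf{y})\mathbf{y}-\mathbf{D}\mathbf{y}+\mathbf{b}.$$ Define the $(2n+1)\times(2n+1)$ real matrix $$\mathbf{M}=\begin{pmatrix}\mathbf{D}&-\operatorname{diag}(\mathbf{b})&\mathbf{0}\\ \mathbf{O}&\mathbf{D}&-\mathbf{b}\\ \mathbf{1}^T&\mathbf{0}^T&0\end{pmatrix},$$ with block sizes $n,n,1$, where $\mathbf{O}$ is the $n\times n$ zero matrix and $\mathbf{1}\in\mathbb{R}^n$ is the all-ones vector. For a matrix $\mathbf{B}$, $\mathbf{B}^{+}$ denotes its Moore–Penrose pseudoinverse. Stationary points are allowed to be complex: a stationary point of $f$ is a $\mathbf{y}\in\mathbb{C}^n$ with $(\mathbf{y}^T\mathbf{y})\mathbf{y}-\mathbf{D}\mathbf{y}+\mathbf{b}=\mathbf{0}$, where $\mathbf{y}^T\mathbf{y}=\sum_k y_k^2$ (no complex conjugation); correspondingly the kernel is taken in $\mathbb{C}^n$. *)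

theory Defs
  imports "HOL-Analysis.Analysis"
begin

section \<open>The squared-range objective and its diagonalised gradient\<close>

text \<open>Senders \<open>s\<close> and distances \<open>d\<close> are families over the finite type \<open>'m\<close>; coordinates are
  indexed by the finite type \<open>'n\<close>.\<close>

definition hfun :: "real^'m^'m \<Rightarrow> ('m \<Rightarrow> real^'n) \<Rightarrow> ('m \<Rightarrow> real) \<Rightarrow> real^'n \<Rightarrow> real" where
  "hfun W s d x =
     1/4 * (\<Sum>i\<in>UNIV. \<Sum>j\<in>UNIV.
        W$i$j * ((norm (x - s i))\<^sup>2 - (d i)\<^sup>2) * ((norm (x - s j))\<^sup>2 - (d j)\<^sup>2))"

definition ffun ::
    "real^'m^'m \<Rightarrow> ('m \<Rightarrow> real^'n) \<Rightarrow> ('m \<Rightarrow> real) \<Rightarrow> real^'n^'n \<Rightarrow> real^'n \<Rightarrow> real" where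
  "ffun W s d Q y = hfun W s d (Q *v y)"

definition Amat :: "real^'m^'m \<Rightarrow> ('m \<Rightarrow> real^'n) \<Rightarrow> ('m \<Rightarrow> real) \<Rightarrow> real^'n^'n" where
  "Amat W s d =
     - (\<Sum>i\<in>UNIV. \<Sum>j\<in>UNIV.
          W$i$j *\<^sub>R (2 *\<^sub>R (columnvector (s j) ** (rowvector (s i) :: real^'n^1))
                    + mat (s i \<bullet> s i - (d i)\<^sup>2)))"

definition gvec :: "real^'m^'m \<Rightarrow> ('m \<Rightarrow> real^'n) \<Rightarrow> ('m \<Rightarrow> real) \<Rightarrow> real^'n" where
  "gvec W s d =
     - (\<Sum>i\<in>UNIV. \<Sum>j\<in>UNIV. (W$i$j * (s i \<bullet> s i - (d i)\<^sup>2)) *\<^sub>R s j)"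

definition positive_definite :: "real^'m^'m \<Rightarrow> bool" where
  "positive_definite W \<longleftrightarrow> transpose W = W \<and> (\<forall>x. x \<noteq> 0 \<longrightarrow> x \<bullet> (W *v x) > 0)"

text \<open>The index type \<open>'n + 'n + 1\<close> associates to the right, so the blocks are addressed by
  \<open>Inl\<close>, \<open>Inr \<circ> Inl\<close> and \<open>Inr \<circ> Inr\<close>.\<close>

definition Mmat :: "real^'n^'n \<Rightarrow> real^'n \<Rightarrow> real^('n + 'n + 1)^('n + 'n + 1)" where
  "Mmat D b = (\<chi> r c.
     case r of
       Inl i \<Rightarrow> (case c of
           Inl j \<Rightarrow> D$i$j
         | Inr (Inl j) \<Rightarrow> (if i = j then - b$i else 0)
         | Inr (Inr _) \<Rightarrow> 0)
     | Inr (Inl i) \<Rightarrow> (case c of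
           Inl j \<Rightarrow> 0
         | Inr (Inl j) \<Rightarrow> D$i$j
         | Inr (Inr _) \<Rightarrow> - b$i)
     | Inr (Inr _) \<Rightarrow> (case c of
           Inl j \<Rightarrow> 1
         | Inr (Inl j) \<Rightarrow> 0
         | Inr (Inr _) \<Rightarrow> 0))"


section \<open>Complex linear algebra\<close>

definition cvec :: "real^'n \<Rightarrow> complex^'n" where
  "cvec v = (\<chi> i. complex_of_real (v$i))"

abbreviation cmat :: "real^'n^'m \<Rightarrow> complex^'n^'m" where
  "cmat \<equiv> map_matrix complex_of_real"

definition eigenvalue :: "'a::field^'n^'n \<Rightarrow> 'a \<Rightarrow> bool" where
  "eigenvalue B l \<longleftrightarrow> (\<exists>v. v \<noteq> 0 \<and> B *v v = l *s v)"

definition adjoint_mat :: "complex^'n^'m \<Rightarrow> complex^'m^'n" where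
  "adjoint_mat B = transpose (map_matrix cnj B)"

definition is_pinv :: "complex^'n^'m \<Rightarrow> complex^'m^'n \<Rightarrow> bool" where
  "is_pinv B X \<longleftrightarrow>
     B ** X ** B = B \<and> X ** B ** X = X \<and>
     adjoint_mat (B ** X) = B ** X \<and> adjoint_mat (X ** B) = X ** B"

definition pinv :: "complex^'n^'m \<Rightarrow> complex^'m^'n" where
  "pinv B = (THE X. is_pinv B X)"

lemma adjoint_mat_mult: "adjoint_mat (A ** B) = adjoint_mat B ** adjoint_mat A"
  by (simp add: adjoint_mat_def transpose_def matrix_matrix_mult_def vec_eq_iff mult.commute)

lemma is_pinv_unique:
  assumes X: "is_pinv B X" and Y: "is_pinv B Y"
  shows "X = Y"
proof -
  have "B ** X = (B ** Y) ** (B ** X)"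
    using Y by (simp add: is_pinv_def matrix_mul_assoc)
  also have "\<dots> = adjoint_mat (B ** X ** (B ** Y))"
    using X Y by (simp add: is_pinv_def adjoint_mat_mult[of "B ** X" "B ** Y"])
  also have "\<dots> = B ** Y"
    using X Y by (simp add: is_pinv_def matrix_mul_assoc)
  finally have BX: "B ** X = B ** Y" .
  have "X ** B = (X ** B) ** (Y ** B)"
    using Y by (metis is_pinv_def matrix_mul_assoc)
  also have "\<dots> = adjoint_mat (Y ** B ** (X ** B))"
    using X Y by (simp add: is_pinv_def adjoint_mat_mult[of "Y ** B" "X ** B"])
  also have "\<dots> = Y ** B"
    using X Y by (metis is_pinv_def matrix_mul_assoc)
  finally have XB: "X ** B = Y ** B" .
  show ?thesis
    using X Y BX XB by (metis is_pinv_def matrix_mul_assoc)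
qed

lemma pinv_eqI: "is_pinv B X \<Longrightarrow> pinv B = X"
  unfolding pinv_def by (blast intro: the_equality is_pinv_unique)


section \<open>Stationary points\<close>

text \<open>Complex zeros of the polynomial map \<open>\<nabla>f\<close>. The product \<open>scalar_product y y\<close> is
  \<open>\<Sum>k. y\<^sub>k\<^sup>2\<close>, without conjugation. That this map is the gradient of \<open>ffun\<close> is
  \<open>gderiv_ffun\<close> below.\<close>

definition stationary_point :: "real^'n^'n \<Rightarrow> real^'n \<Rightarrow> complex^'n \<Rightarrow> bool" where
  "stationary_point D b y \<longleftrightarrow> scalar_product y y *s y - cmat D *v y + cvec b = 0"

lemma gderiv_hfun:
  fixes W :: "real^'m^'m" and s :: "'m \<Rightarrow> real^'n"
  assumes sym: "transpose W = W"
    and one: "(\<Sum>i\<in>UNIV. \<Sum>j\<in>UNIV. W$i$j) = 1"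
    and zero: "(\<Sum>i\<in>UNIV. \<Sum>j\<in>UNIV. W$i$j *\<^sub>R s i) = 0"
  shows "GDERIV (hfun W s d) x :> (x \<bullet> x) *\<^sub>R x - Amat W s d *v x + gvec W s d"
proof -
  have W: "W$j$i = W$i$j" for i j
    using sym by (metis transpose_def vec_lambda_beta)
  have zero': "(\<Sum>i\<in>UNIV. \<Sum>j\<in>UNIV. W$i$j *\<^sub>R s j) = 0"
    using zero by (subst sum.swap) (simp add: W)
  define p where "p i = (norm (x - s i))\<^sup>2 - (d i)\<^sup>2" for i
  define c where "c i = s i \<bullet> s i - (d i)\<^sup>2" for i
  have p: "p i = x \<bullet> x - 2 * (s i \<bullet> x) + c i" for i
    by (simp add: p_def c_def power2_norm_eq_inner inner_diff_left inner_diff_right inner_commute)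
  have G: "(\<Sum>i\<in>UNIV. \<Sum>j\<in>UNIV. (W$i$j * p i) *\<^sub>R (x - s j))
      = (x \<bullet> x) *\<^sub>R x - Amat W s d *v x + gvec W s d"
  proof -
    have out: "(columnvector (s j) ** (rowvector (s i) :: real^'n^1)) *v x = (s i \<bullet> x) *\<^sub>R s j" for i j
      by (simp add: vec_eq_iff matrix_vector_mult_def matrix_matrix_mult_def columnvector_def
          rowvector_def inner_vec_def sum_distrib_left mult_ac)
    have m: "(mat r :: real^'n^'n) *v x = r *\<^sub>R x" for r
      by (simp add: vec_eq_iff matrix_vector_mult_def mat_def if_distrib[of "\<lambda>z. z * _"] cong: if_cong)
    have sumv: "(\<Sum>i\<in>I. F i) *v x = (\<Sum>i\<in>I. F i *v x)" for F :: "'m \<Rightarrow> real^'n^'n" and I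
      by (induction I rule: infinite_finite_induct) (auto simp: matrix_vector_mult_add_rdistrib)
    have scv: "(r *\<^sub>R F) *v x = r *\<^sub>R (F *v x)" for F :: "real^'n^'n" and r
      by (simp add: scaleR_matrix_vector_assoc)
    have neg: "(- F) *v x = - (F *v x)" for F :: "real^'n^'n"
      by (simp add: vec_eq_iff matrix_vector_mult_def sum_negf)
    have A: "Amat W s d *v x = - (\<Sum>i\<in>UNIV. \<Sum>j\<in>UNIV.
        W$i$j *\<^sub>R (2 *\<^sub>R ((s i \<bullet> x) *\<^sub>R s j) + c i *\<^sub>R x))"
      by (simp add: Amat_def neg sumv scv out m matrix_vector_mult_add_rdistrib c_def)
    have t1: "(\<Sum>i\<in>UNIV. \<Sum>j\<in>UNIV. (W$i$j * (x \<bullet> x)) *\<^sub>R x) = (x \<bullet> x) *\<^sub>R x"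
      using one by (simp add: sum_distrib_right[symmetric] scaleR_sum_left[symmetric])
    have t2: "(\<Sum>i\<in>UNIV. \<Sum>j\<in>UNIV. (W$i$j * (x \<bullet> x)) *\<^sub>R s j) = 0"
    proof -
      have "(\<Sum>i\<in>UNIV. \<Sum>j\<in>UNIV. (W$i$j * (x \<bullet> x)) *\<^sub>R s j)
          = (x \<bullet> x) *\<^sub>R (\<Sum>i\<in>UNIV. \<Sum>j\<in>UNIV. W$i$j *\<^sub>R s j)"
        by (simp add: scaleR_sum_right mult.commute)
      then show ?thesis by (simp add: zero')
    qed
    have t3: "(\<Sum>i\<in>UNIV. \<Sum>j\<in>UNIV. (W$i$j * (2 * (s i \<bullet> x))) *\<^sub>R x) = 0"
    proof -
      have "(\<Sum>i\<in>UNIV. \<Sum>j\<in>UNIV. (W$i$j * (2 * (s i \<bullet> x))) *\<^sub>R x)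
          = (2 * ((\<Sum>i\<in>UNIV. \<Sum>j\<in>UNIV. W$i$j *\<^sub>R s i) \<bullet> x)) *\<^sub>R x"
        by (simp add: inner_sum_left scaleR_sum_left sum_distrib_left mult_ac)
      then show ?thesis by (simp add: zero)
    qed
    have "(\<Sum>i\<in>UNIV. \<Sum>j\<in>UNIV. (W$i$j * p i) *\<^sub>R (x - s j))
      = (\<Sum>i\<in>UNIV. \<Sum>j\<in>UNIV. (W$i$j * (x \<bullet> x)) *\<^sub>R x)
        - (\<Sum>i\<in>UNIV. \<Sum>j\<in>UNIV. (W$i$j * (x \<bullet> x)) *\<^sub>R s j)
        - (\<Sum>i\<in>UNIV. \<Sum>j\<in>UNIV. (W$i$j * (2 * (s i \<bullet> x))) *\<^sub>R x)
        + (\<Sum>i\<in>UNIV. \<Sum>j\<in>UNIV. W$i$j *\<^sub>R (2 *\<^sub>R ((s i \<bullet> x) *\<^sub>R s j) + c i *\<^sub>R x))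
        - (\<Sum>i\<in>UNIV. \<Sum>j\<in>UNIV. (W$i$j * c i) *\<^sub>R s j)"
      by (simp add: p sum_subtractf[symmetric] sum.distrib[symmetric] algebra_simps)
    then show ?thesis
      by (simp add: t1 t2 t3 A gvec_def c_def)
  qed
  have "GDERIV (hfun W s d) x :> (\<Sum>i\<in>UNIV. \<Sum>j\<in>UNIV. (W$i$j * p i) *\<^sub>R (x - s j))"
  proof -
    have swap: "(\<Sum>i\<in>UNIV. \<Sum>j\<in>UNIV. W$i$j * p j * (v \<bullet> (x - s i)))
        = (\<Sum>i\<in>UNIV. \<Sum>j\<in>UNIV. W$i$j * p i * (v \<bullet> (x - s j)))" for v
      by (subst sum.swap) (simp add: W)
    have q: "hfun W s d = (\<lambda>x. 1/4 * (\<Sum>i\<in>UNIV. \<Sum>j\<in>UNIV.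
        W$i$j * ((x - s i) \<bullet> (x - s i) - (d i)\<^sup>2) * ((x - s j) \<bullet> (x - s j) - (d j)\<^sup>2)))"
      by (simp add: hfun_def fun_eq_iff power2_norm_eq_inner)
    have "(hfun W s d has_derivative (\<lambda>v. 1/4 * (\<Sum>i\<in>UNIV. \<Sum>j\<in>UNIV.
        2 * (W$i$j * p j * (v \<bullet> (x - s i))) + 2 * (W$i$j * p i * (v \<bullet> (x - s j)))))) (at x)"
      unfolding q
      by (rule derivative_eq_intros refl | simp)+
         (simp add: p_def power2_norm_eq_inner inner_commute algebra_simps)
    also have "(\<lambda>v. 1/4 * (\<Sum>i\<in>UNIV. \<Sum>j\<in>UNIV.
        2 * (W$i$j * p j * (v \<bullet> (x - s i))) + 2 * (W$i$j * p i * (v \<bullet> (x - s j)))))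
        = (\<lambda>v. v \<bullet> (\<Sum>i\<in>UNIV. \<Sum>j\<in>UNIV. (W$i$j * p i) *\<^sub>R (x - s j)))"
      by (simp only: sum.distrib sum_distrib_left[symmetric] swap inner_sum_right inner_scaleR_right)
         simp
    finally show ?thesis unfolding gderiv_def .
  qed
  then show ?thesis unfolding G .
qed

lemma gderiv_ffun:
  fixes W :: "real^'m^'m" and s :: "'m \<Rightarrow> real^'n"
  assumes "transpose W = W"
    and "(\<Sum>i\<in>UNIV. \<Sum>j\<in>UNIV. W$i$j) = 1"
    and "(\<Sum>i\<in>UNIV. \<Sum>j\<in>UNIV. W$i$j *\<^sub>R s i) = 0"
    and Q: "orthogonal_matrix Q"
    and D: "D = transpose Q ** Amat W s d ** Q"
    and b: "b = transpose Q *v gvec W s d"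
  shows "GDERIV (ffun W s d Q) y :> (y \<bullet> y) *\<^sub>R y - D *v y + b"
proof -
  let ?g = "\<lambda>x. (x \<bullet> x) *\<^sub>R x - Amat W s d *v x + gvec W s d"
  have tr: "(Q *v v) \<bullet> w = v \<bullet> (transpose Q *v w)" for v w
    by (metis dot_lmul_matrix inner_commute transpose_matrix_vector)
  have QQ: "transpose Q *v (Q *v v) = v" for v
    using Q by (simp add: matrix_vector_mul_assoc orthogonal_matrix)
  have "((\<lambda>y. Q *v y) has_derivative (\<lambda>v. Q *v v)) (at y)"
    by (intro bounded_linear_imp_has_derivative matrix_vector_mul_bounded_linear)
  then have "((\<lambda>y. hfun W s d (Q *v y)) has_derivative (\<lambda>v. (Q *v v) \<bullet> ?g (Q *v y))) (at y)"
    using gderiv_hfun[OF assms(1-3), of d "Q *v y"] unfolding gderiv_def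
    by (rule has_derivative_compose)
  moreover have "transpose Q *v ?g (Q *v y) = (y \<bullet> y) *\<^sub>R y - D *v y + b"
    using QQ[unfolded transpose_matrix_vector]
    by (simp add: D b tr matrix_vector_right_distrib matrix_vector_mult_diff_distrib
        matrix_vector_mult_scaleR matrix_vector_mul_assoc[symmetric] transpose_matrix_vector)
  moreover have "ffun W s d Q = (\<lambda>y. hfun W s d (Q *v y))"
    by (simp add: ffun_def fun_eq_iff)
  ultimately show ?thesis
    by (simp add: gderiv_def tr)
qed

lemma stationary_point_cvec:
  "stationary_point D b (cvec y) \<longleftrightarrow> (y \<bullet> y) *\<^sub>R y - D *v y + b = 0"
proof -
  have "scalar_product (cvec y) (cvec y) *s cvec y - cmat D *v cvec y + cvec b
      = cvec ((y \<bullet> y) *\<^sub>R y - D *v y + b)"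
    by (simp add: vec_eq_iff cvec_def scalar_product_def inner_vec_def matrix_vector_mult_def)
  moreover have "cvec v = 0 \<longleftrightarrow> v = 0" for v :: "real^'n"
    by (simp add: vec_eq_iff cvec_def)
  ultimately show ?thesis
    by (simp add: stationary_point_def)
qed

end

theory Submission
  imports Defs
begin

text \<open>For diagonal \<open>D\<close> the pseudoinverse of \<open>\<lambda>I - D\<close> is the diagonal of inverses (with
  \<open>inverse 0 = 0\<close>), so \<open>y\<^sub>p\<close> vanishes wherever \<open>D\<^sub>i\<^sub>i = \<lambda>\<close>, while kernel vectors vanish everywhere
  else. Hence \<open>y\<^sub>p\<^sup>T y\<^sub>h = 0\<close>, so \<open>y\<^sup>T y = \<lambda>\<close>, and stationarity becomes
  \<open>(\<lambda>I - D) y = -b\<close>.\<close>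

definition diagonal :: "('n \<Rightarrow> 'a::zero) \<Rightarrow> 'a^'n^'n" where
  "diagonal c = (\<chi> i j. if i = j then c i else 0)"

lemma diagonal_mult_vec: "(diagonal c *v v) $ i = (c i :: 'a::semiring_1) * v $ i"
  by (simp add: diagonal_def matrix_vector_mult_def if_distrib[of "\<lambda>z. z * _"] cong: if_cong)

lemma diagonal_mult_diagonal:
  "diagonal c ** diagonal e = diagonal (\<lambda>i. (c i :: 'a::semiring_1) * e i)"
  by (simp add: diagonal_def matrix_matrix_mult_def vec_eq_iff if_distrib[of "\<lambda>z. z * _"] cong: if_cong)

lemma adjoint_mat_diagonal: "adjoint_mat (diagonal c) = diagonal (\<lambda>i. cnj (c i))"
  by (simp add: diagonal_def adjoint_mat_def transpose_def map_matrix_def vec_eq_iff)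

text \<open>The Penrose equations decouple into one scalar identity per entry. Where
  \<open>c i = 0\<close> they hold trivially because \<open>inverse 0 = 0\<close>.\<close>

lemma is_pinv_diagonal: "is_pinv (diagonal c) (diagonal (\<lambda>i. inverse (c i)))"
proof -
  have "c i * inverse (c i) * c i = c i" "inverse (c i) * c i * inverse (c i) = inverse (c i)"
    "cnj (c i * inverse (c i)) = c i * inverse (c i)"
    "cnj (inverse (c i) * c i) = inverse (c i) * c i" for i
    by (cases "c i = 0"; simp)+
  then show ?thesis
    by (simp only: is_pinv_def diagonal_mult_diagonal adjoint_mat_diagonal)
qed

text \<open>Solvability puts \<open>v\<close> in the range of \<open>B\<close>, and
  \<open>B ** X\<close> fixes that range by the first Penrose equation.\<close>

lemma pinv_solves:
  assumes "is_pinv B X" and "B *v y = v"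
  shows "B *v (X *v v) = v"
  using assms by (auto simp: is_pinv_def matrix_vector_mul_assoc)

text \<open>The two vectors have disjoint supports: \<open>w\<close> vanishes where
  \<open>c i\<close> is nonzero, the other vector where \<open>c i = 0\<close>. So the product
  vanishes even without conjugation.\<close>

lemma pinv_diagonal_orthogonal_kernel:
  assumes "diagonal c *v w = 0"
  shows "scalar_product (pinv (diagonal c) *v v) w = 0"
proof -
  have "c i * w $ i = 0" for i
    using assms diagonal_mult_vec[of c w i] by simp
  then have "inverse (c i) * v $ i * w $ i = 0" for i
    by (metis inverse_zero mult_eq_0_iff)
  then show ?thesis
    by (simp only: scalar_product_def pinv_eqI[OF is_pinv_diagonal] diagonal_mult_vec sum.neutral_const)
qed

lemma scalar_product_add_self:
  fixes u v :: "'a::comm_semiring_1^'n"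
  shows "scalar_product (u + v) (u + v)
    = scalar_product u u + 2 * scalar_product u v + scalar_product v v"
  by (simp add: scalar_product_def sum.distrib algebra_simps mult_2 mult_2_right)

lemma mat_mult_vec: "mat l *v v = (l :: 'a::semiring_1) *s v"
  by (simp add: vec_eq_iff matrix_vector_mult_def mat_def if_distrib[of "\<lambda>z. z * _"] cong: if_cong)

theorem mainTheorem2:
  fixes W :: "real^'m^'m"
    and s :: "'m \<Rightarrow> real^('n::{finite,linorder})"
    and d :: "'m \<Rightarrow> real"
    and Q D :: "real^('n::{finite,linorder})^('n::{finite,linorder})"
    and b :: "real^('n::{finite,linorder})"
    and lam :: complex
    and yp :: "complex^('n::{finite,linorder})"
  assumes "positive_definite W"
    and "(\<Sum>i\<in>UNIV. \<Sum>j\<in>UNIV. W$i$j) = 1"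
    and "(\<Sum>i\<in>UNIV. \<Sum>j\<in>UNIV. W$i$j *\<^sub>R s i) = 0"
    and "orthogonal_matrix Q"
    and "D = transpose Q ** Amat W s d ** Q"
    and "\<And>i j. i \<noteq> j \<Longrightarrow> D$i$j = 0"
    and "\<And>i j. i \<le> j \<Longrightarrow> D$i$i \<ge> D$j$j"
    and "b = transpose Q *v gvec W s d"
    and "eigenvalue (cmat (Mmat D b)) lam"
    and "\<not> invertible (mat lam - cmat D)"
    and "\<exists>y. (mat lam - cmat D) *v y = - cvec b"
    and "yp = - (pinv (mat lam - cmat D) *v cvec b)"
  shows "\<forall>yh. (mat lam - cmat D) *v yh = 0 \<and>
              scalar_product yh yh = lam - scalar_product yp yp \<longrightarrow>
            stationary_point D b (yp + yh)"
proof (intro allI impI, elim conjE)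
  fix yh
  define B where "B = mat lam - cmat D"
  assume "(mat lam - cmat D) *v yh = 0"
  then have ker: "B *v yh = 0" by (simp add: B_def)
  assume yh: "scalar_product yh yh = lam - scalar_product yp yp"
  have B: "B = diagonal (\<lambda>i. lam - D $ i $ i)"
    using assms(6) by (auto simp: B_def diagonal_def mat_def map_matrix_def vec_eq_iff)
  have yp: "yp = pinv B *v - cvec b"
    using assms(12) by (simp add: B_def vec.neg)
  \<comment> \<open>\<open>pinv\<close> is a definite description, so its Penrose equations need the
    explicit diagonal witness.\<close>
  have "is_pinv B (pinv B)"
    unfolding B by (simp only: pinv_eqI[OF is_pinv_diagonal] is_pinv_diagonal)
  then have "B *v yp = - cvec b"
    using assms(11) unfolding yp B_def by (blast intro: pinv_solves)
  with ker have By: "B *v (yp + yh) = - cvec b"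
    by (simp add: matrix_vector_right_distrib)
  have "scalar_product yp yh = 0"
    using ker unfolding yp B by (rule pinv_diagonal_orthogonal_kernel)
  with yh have "scalar_product (yp + yh) (yp + yh) = lam"
    by (simp add: scalar_product_add_self)
  \<comment> \<open>With \<open>lam\<close> equal to the self-product of \<open>yp + yh\<close>,
    this linear system is the cubic stationarity equation.\<close>
  moreover have "lam *s (yp + yh) - cmat D *v (yp + yh) = - cvec b"
    using By by (simp add: B_def matrix_vector_mult_diff_rdistrib mat_mult_vec)
  ultimately show "stationary_point D b (yp + yh)"
    by (simp add: stationary_point_def)
qed

end
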